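(* Let $(I,\cdot,1)$ be a unitary magma, $(B,+,0,\xi)$ an $I$-module and $(B,\tau)$ a topological space. The following are equivalent: (a) There exist $S\subseteq B$ and $\alpha\colon S\to I$ such that (i) $0\in S$; (ii) $a+\xi(\alpha(a),a')\in S$, for all $a,a'\in S$; for which $\tau$ is determined as $$\mathcal{O}\in \tau \Leftrightarrow \forall x\in \mathcal{O},\ \exists n\in I,\ x+S_n\subseteq \mathcal{O},$$ with $S_n=\{\xi(n,a)\in B\mid a\in S\}$. (b) There exists $S\subseteq B$ such that (i) $0\in S$; (ii) $S\subseteq \{y\in B\mid \exists n\in I,\ y+S_n\subseteq S\}$, with $S_n=\{\xi(n,a)\in B\mid a\in S\}$; for which $\tau$ is determined as $$\mathcal{O}\in \tau \Leftrightarrow \forall x\in \mathcal{O},\ \exists n\in I,\ x+S_n\subseteq \mathcal{O}.$$ (c) There exist $S\in\tau$ and $\gamma\colon\{(U,x)\mid x\in U\in \tau\}\to I$ such that (i) $0\in S$; (ii) $x+S_n \in \tau$ for all $x\in B$ and $n\in I$, with $S_n=\{\xi(n,a)\in B\mid a\in S\}$; (iii) if $x\in U\in\tau$ and $n=\gamma(U,x)$ then $x+S_n\subseteq U$. Moreover, under these conditions (with $S$ and $\alpha$ as in (a)), $(B,\tau)$ is an $I$-cartesian space with $x\leq^n y$ defined as $y=x+\xi(n,a)$ for some $a\in S$ and $\partial^n(x,y)=\alpha(a)\cdot n$ (for such an $a$) if and only if $\xi(n,a)\in S$ for all $a\in S$ and $n\in I$.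
   Context: A unitary magma $(I,\cdot,1)$ is a set $I$ with a distinguished element $1\in I$ and a binary operation $(i,j)\mapsto i\cdot j=ij$ on $I$ such that $i\cdot 1=i=1\cdot i$ for all $i\in I$ (associativity is not required). An $I$-module $(B,+,0,\xi)$ is a monoid $(B,+,0)$ (written additively, not assumed commutative) together with a map $\xi\colon I\times B\to B$ such that for all $n,m\in I$ and $x,y\in B$: (1) $\xi(1,x)=x$ and $\xi(n,0)=0$; (2) $\xi(n,x+y)=\xi(n,x)+\xi(n,y)$; (3) $\xi(n\cdot m,x)=\xi(n,\xi(m,x))=\xi(m,\xi(n,x))$. For $x\in B$ and $T\subseteq B$, $x+T=\{x+t\mid t\in T\}$. A cartesian spacial fibrous preorder indexed by the unitary magma $(I,\cdot,1)$ is a system $(X,(\leq^{i})_{i\in I},(\partial^{i})_{i\in I})$ where $X$ is a set and, for every $i\in I$, $\leq^{i}$ is a binary relation on $X$ and $\partial^{i}$ is a partial map $X\times X\to I$ defined for all pairs $(x,y)$ such that $x\leq^{i} y$, such that for all $x,y,z\in X$ and $i,j\in I$: (C1) $x\leq^{i} x$; (C2) if $x\leq^{i} y$, $\partial^{i}(x,y)=j$ and $y\leq^{j} z$, then $x\leq^{i} z$; (C3) if $x\leq^{ij} y$, then $x\leq^{i} y$ and $x\leq^{j} y$. Every such system gives rise to a topology on $X$ in which $\mathcal{O}\subseteq X$ is open if and only if for every $x\in\mathcal{O}$ there is $i\in I$ with $\{y\in X\mid x\leq^{i}y\}\subseteq\mathcal{O}$. A topological space is called $I$-cartesian if it is obtained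 in this way from some cartesian spacial fibrous preorder indexed by $I$; saying that it is $I$-cartesian with given $\leq^{n}$ and $\partial^{n}$ means that the system formed by these $\leq^{n}$ and $\partial^{n}$ is a cartesian spacial fibrous preorder indexed by $I$ which gives rise to its topology. *)

theory Defs
  imports "HOL-Analysis.Abstract_Topology" "HOL-Library.Set_Algebras"
begin

locale unitary_magma =
  fixes mult :: "'i \<Rightarrow> 'i \<Rightarrow> 'i" and one :: 'i
  assumes mult_one: "mult i one = i"
    and one_mult: "mult one i = i"

text \<open>The class \<^class>\<open>monoid_add\<close> does not include commutativity of addition.\<close>

locale magma_module = unitary_magma mult one
  for mult :: "'i \<Rightarrow> 'i \<Rightarrow> 'i" and one :: 'i +
  fixes \<xi> :: "'i \<Rightarrow> 'b \<Rightarrow> ('b :: monoid_add)"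
  assumes act_one: "\<xi> one x = x"
    and act_zero: "\<xi> n 0 = 0"
    and act_add: "\<xi> n (x + y) = \<xi> n x + \<xi> n y"
    and act_mult: "\<xi> (mult n m) x = \<xi> n (\<xi> m x)"
    and act_mult': "\<xi> (mult n m) x = \<xi> m (\<xi> n x)"

text \<open>
  A partial map from pairs of points to indices is a curried option-valued function,
  with value \<^const>\<open>None\<close> outside its domain.
\<close>

locale cartesian_fibrous_preorder = unitary_magma mult one
  for mult :: "'i \<Rightarrow> 'i \<Rightarrow> 'i" and one :: 'i +
  fixes le :: "'i \<Rightarrow> 'x \<Rightarrow> 'x \<Rightarrow> bool"
    and \<delta> :: "'i \<Rightarrow> 'x \<Rightarrow> 'x \<Rightarrow> 'i option"
  assumes domain: "\<delta> i x y \<noteq> None \<longleftrightarrow> le i x y"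
    and refl: "le i x x"
    and trans: "le i x y \<Longrightarrow> \<delta> i x y = Some j \<Longrightarrow> le j y z \<Longrightarrow> le i x z"
    and le_mult: "le (mult i j) x y \<Longrightarrow> le i x y \<and> le j x y"

definition cartesian_space_with ::
  "('i \<Rightarrow> 'i \<Rightarrow> 'i) \<Rightarrow> 'i \<Rightarrow> 'x topology \<Rightarrow> ('i \<Rightarrow> 'x \<Rightarrow> 'x \<Rightarrow> bool) \<Rightarrow>
    ('i \<Rightarrow> 'x \<Rightarrow> 'x \<Rightarrow> 'i option) \<Rightarrow> bool" where
  "cartesian_space_with mult one \<tau> le \<delta> \<longleftrightarrow>
    cartesian_fibrous_preorder mult one le \<delta> \<and>
    (\<forall>W. openin \<tau> W \<longleftrightarrow> (\<forall>x\<in>W. \<exists>i. {y. le i x y} \<subseteq> W))"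

text \<open>The set \<open>S\<^sub>n\<close> is the image \<open>\<xi> n ` S\<close>, and \<open>x +o T\<close> is the translate \<open>x + T\<close>.\<close>

definition determines ::
  "('i \<Rightarrow> 'b \<Rightarrow> 'b) \<Rightarrow> 'b set \<Rightarrow> ('b :: monoid_add) topology \<Rightarrow> bool" where
  "determines \<xi> S \<tau> \<longleftrightarrow>
    (\<forall>W. openin \<tau> W \<longleftrightarrow> (\<forall>x\<in>W. \<exists>n. x +o \<xi> n ` S \<subseteq> W))"

definition le_of ::
  "('i \<Rightarrow> 'b \<Rightarrow> 'b) \<Rightarrow> 'b set \<Rightarrow> 'i \<Rightarrow> 'b \<Rightarrow> ('b :: monoid_add) \<Rightarrow> bool" where
  "le_of \<xi> S n x y \<longleftrightarrow> (\<exists>a\<in>S. y = x + \<xi> n a)"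

text \<open>
  Several \<open>a \<in> S\<close> may satisfy \<open>y = x + \<xi> n a\<close>, with different \<open>\<alpha> a\<close>. The next predicate
  says that \<open>\<delta>\<close> arises by choosing one such \<open>a\<close> for every \<open>n\<close>, \<open>x\<close>, \<open>y\<close> that admits one.
\<close>

definition is_partial_of ::
  "('i \<Rightarrow> 'i \<Rightarrow> 'i) \<Rightarrow> ('i \<Rightarrow> 'b \<Rightarrow> 'b) \<Rightarrow> 'b set \<Rightarrow> ('b \<Rightarrow> 'i) \<Rightarrow>
    ('i \<Rightarrow> 'b \<Rightarrow> ('b :: monoid_add) \<Rightarrow> 'i option) \<Rightarrow> bool" where
  "is_partial_of mult \<xi> S \<alpha> \<delta> \<longleftrightarrow>
    (\<forall>n x y.
      if le_of \<xi> S n x y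
      then \<exists>a\<in>S. y = x + \<xi> n a \<and> \<delta> n x y = Some (mult (\<alpha> a) n)
      else \<delta> n x y = None)"

end

theory Submission
  imports Defs
begin

text \<open>
  If \<open>a + \<xi> m s \<in> S\<close> for all \<open>s \<in> S\<close>, then \<open>(x + \<xi> n a) + \<xi> (n \<cdot> m) s = x + \<xi> n (a + \<xi> m s)\<close>, so every
  \<open>x + S\<^sub>n\<close> is open; this links (b) with (c), and (a) is (b) with a choice of \<open>m\<close> for every \<open>a\<close>.
  For the last claim, axiom (C3) applied to \<open>n = 1 \<cdot> n\<close> and \<open>0 \<le>\<^sup>n \<xi> n a\<close> gives
  \<open>0 \<le>\<^sup>1 \<xi> n a\<close>, that is, \<open>\<xi> n a \<in> S\<close>.
\<close>

context magma_module
begin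

text \<open>By the second assumption each point of \<open>S\<close> has a basic neighbourhood inside
  \<open>S\<close>. Additivity of \<open>\<xi> n\<close> and the composition law carry this property
  over to the translate \<open>x + S\<^sub>n\<close>, where \<open>det\<close> reads it as
  openness.\<close>

lemma basic_neighbourhood_open:
  assumes det: "determines \<xi> S \<tau>" and S: "S \<subseteq> {y. \<exists>n. y +o \<xi> n ` S \<subseteq> S}"
  shows "openin \<tau> (x +o \<xi> n ` S)"
proof -
  have "\<exists>k. y +o \<xi> k ` S \<subseteq> x +o \<xi> n ` S" if "y \<in> x +o \<xi> n ` S" for y
  proof -
    from that obtain a where a: "a \<in> S" "y = x + \<xi> n a"
      by (auto simp: elt_set_plus_def)
    with S obtain m where m: "a +o \<xi> m ` S \<subseteq> S" by blast
    have "y + \<xi> (mult n m) s \<in> x +o \<xi> n ` S" if "s \<in> S" for s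
    proof -
      have "y + \<xi> (mult n m) s = x + \<xi> n (a + \<xi> m s)"
        by (simp add: a act_add act_mult add.assoc)
      moreover have "a + \<xi> m s \<in> S"
        using m that by (auto simp: elt_set_plus_def)
      ultimately show ?thesis by (auto simp: elt_set_plus_def)
    qed
    then have "y +o \<xi> (mult n m) ` S \<subseteq> x +o \<xi> n ` S"
      by (auto simp: elt_set_plus_def)
    then show ?thesis ..
  qed
  with det show ?thesis
    unfolding determines_def by blast
qed

text \<open>The axiom of choice turns an index for every \<open>a \<in> S\<close> into a function
  \<open>\<alpha>\<close>, whose values outside \<open>S\<close> are arbitrary.\<close>

lemma choice_iff_self_neighbourhood:
  "(\<exists>\<alpha>. \<forall>a\<in>S. \<forall>a'\<in>S. a + \<xi> (\<alpha> a) a' \<in> S) \<longleftrightarrow> S \<subseteq> {y. \<exists>n. y +o \<xi> n ` S \<subseteq> S}"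
proof -
  have "(\<exists>\<alpha>. \<forall>a\<in>S. \<forall>a'\<in>S. a + \<xi> (\<alpha> a) a' \<in> S) \<longleftrightarrow>
      (\<forall>a\<in>S. \<exists>n. \<forall>a'\<in>S. a + \<xi> n a' \<in> S)"
    by metis
  also have "\<dots> \<longleftrightarrow> S \<subseteq> {y. \<exists>n. y +o \<xi> n ` S \<subseteq> S}"
  proof -
    have *: "a +o \<xi> n ` S \<subseteq> S \<longleftrightarrow> (\<forall>a'\<in>S. a + \<xi> n a' \<in> S)" for a n
      by (auto simp: elt_set_plus_def)
    show ?thesis by (auto simp: *)
  qed
  finally show ?thesis .
qed

text \<open>Left to right, the inclusion is the openness criterion for \<open>S\<close> itself, and
  \<open>\<gamma>\<close> chooses the indices that this criterion provides. Right to left, the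
  translates \<open>x + S\<^sub>n\<close> are open and contain \<open>x\<close>, and
  \<open>\<gamma>\<close> finds one inside each open neighbourhood of \<open>x\<close>, so they form
  a neighbourhood base that determines \<open>\<tau>\<close>.\<close>

lemma self_neighbourhood_iff_open_basis:
  assumes "0 \<in> S"
  shows "S \<subseteq> {y. \<exists>n. y +o \<xi> n ` S \<subseteq> S} \<and> determines \<xi> S \<tau> \<longleftrightarrow>
    openin \<tau> S \<and> (\<forall>x n. openin \<tau> (x +o \<xi> n ` S)) \<and>
    (\<exists>\<gamma>. \<forall>U x. openin \<tau> U \<and> x \<in> U \<longrightarrow> x +o \<xi> (\<gamma> (U, x)) ` S \<subseteq> U)"
    (is "?L \<longleftrightarrow> ?R")
proof
  assume L: ?L
  then have "openin \<tau> S"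
    unfolding determines_def by blast
  moreover have "openin \<tau> (x +o \<xi> n ` S)" for x n
    using L basic_neighbourhood_open by blast
  moreover have "\<exists>\<gamma>. \<forall>U x. openin \<tau> U \<and> x \<in> U \<longrightarrow> x +o \<xi> (\<gamma> (U, x)) ` S \<subseteq> U"
  proof -
    have "\<exists>n. x +o \<xi> n ` S \<subseteq> U" if "openin \<tau> U" "x \<in> U" for U x
      using L that unfolding determines_def by blast
    then have "x +o \<xi> (SOME n. x +o \<xi> n ` S \<subseteq> U) ` S \<subseteq> U"
      if "openin \<tau> U" "x \<in> U" for U x
      using that by (intro someI_ex[of "\<lambda>n. x +o \<xi> n ` S \<subseteq> U"]) simp
    then show ?thesis
      by (intro exI[of _ "\<lambda>(U, x). SOME n. x +o \<xi> n ` S \<subseteq> U"]) simp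
  qed
  ultimately show ?R by blast
next
  assume R: ?R
  then obtain \<gamma> where "\<forall>U x. openin \<tau> U \<and> x \<in> U \<longrightarrow> x +o \<xi> (\<gamma> (U, x)) ` S \<subseteq> U"
    by (elim conjE exE)
  then have \<gamma>: "x +o \<xi> (\<gamma> (U, x)) ` S \<subseteq> U" if "openin \<tau> U" "x \<in> U" for U x
    using that by simp
  \<comment> \<open>Here \<open>x = x + \<xi> n 0\<close> with \<open>0 \<in> S\<close>.\<close>
  have centre: "x \<in> x +o \<xi> n ` S" for x n
    using assms act_zero[of n] by (force simp: elt_set_plus_def)
  have "openin \<tau> W \<longleftrightarrow> (\<forall>x\<in>W. \<exists>n. x +o \<xi> n ` S \<subseteq> W)" for W
  proof
    assume W: "\<forall>x\<in>W. \<exists>n. x +o \<xi> n ` S \<subseteq> W"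
    have "\<exists>T. openin \<tau> T \<and> x \<in> T \<and> T \<subseteq> W" if "x \<in> W" for x
    proof -
      from W that obtain n where "x +o \<xi> n ` S \<subseteq> W" by blast
      with R centre show ?thesis by (intro exI[of _ "x +o \<xi> n ` S"]) simp
    qed
    then show "openin \<tau> W" by (subst openin_subopen) simp
  next
    assume "openin \<tau> W"
    then show "\<forall>x\<in>W. \<exists>n. x +o \<xi> n ` S \<subseteq> W" using \<gamma>[of W] by (intro ballI exI)
  qed
  then have "determines \<xi> S \<tau>"
    unfolding determines_def by (rule allI)
  moreover have "S \<subseteq> {y. \<exists>n. y +o \<xi> n ` S \<subseteq> S}"
  proof
    fix y
    assume "y \<in> S"
    \<comment> \<open>The open set to which \<open>\<gamma>\<close> is applied is \<open>S\<close>
      itself.\<close>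
    with R have "y +o \<xi> (\<gamma> (S, y)) ` S \<subseteq> S" by (intro \<gamma>) simp_all
    then show "y \<in> {y. \<exists>n. y +o \<xi> n ` S \<subseteq> S}" by blast
  qed
  ultimately show ?L by (intro conjI)
qed

lemma cartesian_space_with_le_of_iff:
  assumes zero: "0 \<in> S"
    and closed: "\<forall>a\<in>S. \<forall>a'\<in>S. a + \<xi> (\<alpha> a) a' \<in> S"
    and det: "determines \<xi> S \<tau>"
    and \<delta>: "is_partial_of mult \<xi> S \<alpha> \<delta>"
  shows "cartesian_space_with mult one \<tau> (le_of \<xi> S) \<delta> \<longleftrightarrow> (\<forall>a\<in>S. \<forall>n. \<xi> n a \<in> S)"
proof
  assume "cartesian_space_with mult one \<tau> (le_of \<xi> S) \<delta>"
  then interpret cartesian_fibrous_preorder mult one "le_of \<xi> S" \<delta>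
    by (simp add: cartesian_space_with_def)
  have "\<xi> n a \<in> S" if "a \<in> S" for a n
  proof -
    have "le_of \<xi> S (mult one n) 0 (\<xi> n a)"
      using that by (auto simp: le_of_def one_mult)
    then have "le_of \<xi> S one 0 (\<xi> n a)"
      using le_mult by blast
    then show ?thesis
      by (auto simp: le_of_def act_one)
  qed
  then show "\<forall>a\<in>S. \<forall>n. \<xi> n a \<in> S" by blast
next
  assume stable: "\<forall>a\<in>S. \<forall>n. \<xi> n a \<in> S"
  have "cartesian_fibrous_preorder mult one (le_of \<xi> S) \<delta>"
  proof
    fix i x y
    show "\<delta> i x y \<noteq> None \<longleftrightarrow> le_of \<xi> S i x y"
      using \<delta> unfolding is_partial_of_def by (metis option.distinct(1))
  next
    fix i x
    show "le_of \<xi> S i x x"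
      using zero act_zero[of i] by (force simp: le_of_def)
  next
    fix i j x y z
    assume "le_of \<xi> S i x y" "\<delta> i x y = Some j" "le_of \<xi> S j y z"
    \<comment> \<open>The point \<open>a\<close> must be the one chosen by \<open>\<delta>\<close>,
      not any witness of the relation, since \<open>j\<close> is built from its value
      \<open>\<alpha> a\<close>.\<close>
    with \<delta> obtain a b where "a \<in> S" "b \<in> S"
      and "y = x + \<xi> i a" "z = y + \<xi> (mult (\<alpha> a) i) b"
      unfolding is_partial_of_def le_of_def by (metis option.inject)
    \<comment> \<open>The index \<open>mult (\<alpha> a) i\<close> has \<open>i\<close> on the
      right, so \<open>act_mult'\<close> is the law that puts \<open>\<xi> i\<close> outermost. Then
      \<open>closed\<close> gives \<open>a + \<xi> (\<alpha> a) b \<in> S\<close>.\<close>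
    moreover from this have "z = x + \<xi> i (a + \<xi> (\<alpha> a) b)"
      by (simp add: act_add act_mult' add.assoc)
    ultimately show "le_of \<xi> S i x z"
      using closed unfolding le_of_def by blast
  next
    fix i j x y
    assume "le_of \<xi> S (mult i j) x y"
    then obtain a where a: "a \<in> S" "y = x + \<xi> (mult i j) a"
      by (auto simp: le_of_def)
    \<comment> \<open>The witnesses for the two halves of (C3) are \<open>\<xi> j a\<close> and
      \<open>\<xi> i a\<close>, which lie in \<open>S\<close> by \<open>stable\<close>.\<close>
    have "y = x + \<xi> i (\<xi> j a)" "y = x + \<xi> j (\<xi> i a)"
      using a act_mult act_mult' by simp_all
    with a stable show "le_of \<xi> S i x y \<and> le_of \<xi> S j x y"
      unfolding le_of_def by blast
  qed
  \<comment> \<open>With this identity the topology of the preorder is the one described by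
    \<open>determines\<close>.\<close>
  moreover have "{y. le_of \<xi> S n x y} = x +o \<xi> n ` S" for n x
    by (auto simp: le_of_def elt_set_plus_def)
  ultimately show "cartesian_space_with mult one \<tau> (le_of \<xi> S) \<delta>"
    using det by (simp add: cartesian_space_with_def determines_def)
qed

end

theorem theorem6p2:
  fixes mult :: "'i \<Rightarrow> 'i \<Rightarrow> 'i" and one :: 'i
    and \<xi> :: "'i \<Rightarrow> 'b \<Rightarrow> ('b :: monoid_add)"
    and \<tau> :: "'b topology"
  assumes "magma_module mult one \<xi>"
    and "topspace \<tau> = UNIV"
  shows "((\<exists>S (\<alpha> :: 'b \<Rightarrow> 'i).
            0 \<in> S \<and>
            (\<forall>a\<in>S. \<forall>a'\<in>S. a + \<xi> (\<alpha> a) a' \<in> S) \<and>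
            determines \<xi> S \<tau>)
         \<longleftrightarrow>
         (\<exists>S.
            0 \<in> S \<and>
            S \<subseteq> {y. \<exists>n. y +o \<xi> n ` S \<subseteq> S} \<and>
            determines \<xi> S \<tau>)) \<and>
        ((\<exists>S.
            0 \<in> S \<and>
            S \<subseteq> {y. \<exists>n. y +o \<xi> n ` S \<subseteq> S} \<and>
            determines \<xi> S \<tau>)
         \<longleftrightarrow>
         (\<exists>S (\<gamma> :: 'b set \<times> 'b \<Rightarrow> 'i).
            openin \<tau> S \<and>
            0 \<in> S \<and>
            (\<forall>x n. openin \<tau> (x +o \<xi> n ` S)) \<and>
            (\<forall>U x. openin \<tau> U \<and> x \<in> U \<longrightarrow> x +o \<xi> (\<gamma> (U, x)) ` S \<subseteq> U))) \<and>
        (\<forall>S (\<alpha> :: 'b \<Rightarrow> 'i) \<delta>.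
           0 \<in> S \<and>
           (\<forall>a\<in>S. \<forall>a'\<in>S. a + \<xi> (\<alpha> a) a' \<in> S) \<and>
           determines \<xi> S \<tau> \<and>
           is_partial_of mult \<xi> S \<alpha> \<delta> \<longrightarrow>
           (cartesian_space_with mult one \<tau> (le_of \<xi> S) \<delta> \<longleftrightarrow>
            (\<forall>a\<in>S. \<forall>n. \<xi> n a \<in> S)))"
proof (intro conjI)
  interpret magma_module mult one \<xi> by fact
  show "(\<exists>S (\<alpha> :: 'b \<Rightarrow> 'i). 0 \<in> S \<and> (\<forall>a\<in>S. \<forall>a'\<in>S. a + \<xi> (\<alpha> a) a' \<in> S) \<and> determines \<xi> S \<tau>) \<longleftrightarrow>
      (\<exists>S. 0 \<in> S \<and> S \<subseteq> {y. \<exists>n. y +o \<xi> n ` S \<subseteq> S} \<and> determines \<xi> S \<tau>)"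
    by (simp flip: choice_iff_self_neighbourhood)
  show "(\<exists>S. 0 \<in> S \<and> S \<subseteq> {y. \<exists>n. y +o \<xi> n ` S \<subseteq> S} \<and> determines \<xi> S \<tau>) \<longleftrightarrow>
      (\<exists>S (\<gamma> :: 'b set \<times> 'b \<Rightarrow> 'i). openin \<tau> S \<and> 0 \<in> S \<and>
        (\<forall>x n. openin \<tau> (x +o \<xi> n ` S)) \<and>
        (\<forall>U x. openin \<tau> U \<and> x \<in> U \<longrightarrow> x +o \<xi> (\<gamma> (U, x)) ` S \<subseteq> U))"
    (is "(\<exists>S. ?z S \<and> ?b S \<and> ?d S) \<longleftrightarrow> (\<exists>S \<gamma>. ?o S \<and> ?z S \<and> ?t S \<and> ?g S \<gamma>)")
  \<comment> \<open>The same \<open>S\<close> serves on both sides, so it can be fixed. The conjunct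
    \<open>0 \<in> S\<close> is then available as the assumption of the lemma.\<close>
  proof (intro ex_cong1)
    fix S
    have "?z S \<and> ?b S \<and> ?d S \<longleftrightarrow> ?z S \<and> ?o S \<and> ?t S \<and> (\<exists>\<gamma>. ?g S \<gamma>)"
      by (intro conj_cong refl self_neighbourhood_iff_open_basis)
    then show "?z S \<and> ?b S \<and> ?d S \<longleftrightarrow> (\<exists>\<gamma>. ?o S \<and> ?z S \<and> ?t S \<and> ?g S \<gamma>)"
      by (simp only: ex_simps conj_ac)
  qed
qed (intro allI impI, elim conjE,
    rule magma_module.cartesian_space_with_le_of_iff[OF assms(1)])

end
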